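(* Let $I\subset S=K[x_1,\ldots,x_n]$ be a monomial ideal and let $q$ be a positive integer. Then $\operatorname{Ass}(S/I)=\operatorname{Ass}(S/I^{[q]})$, where $I^{[q]}$ is the $q$-th bracket power of $I$. In particular, if $I$ is of Borel type, then $I^{[q]}$ is of Borel type.
   Context: $K$ is an infinite field and $S=K[x_1,\ldots,x_n]$, $n\geq 2$, is the polynomial ring. $\operatorname{Ass}(S/I)$ is the set of associated primes of the $S$-module $S/I$. Bracket power: for a monomial ideal $I$, $I^{[q]}$ is the ideal generated by all $u^q$ with $u\in I$ a monomial. Borel type: a monomial ideal $I\subset S$ is of Borel type if $(I:x_j^\infty)=(I:(x_1,\ldots,x_j)^\infty)$ for all $j=1,\ldots,n$, where $(I:J^\infty)=\bigcup_{k\ge 0}(I:J^k)$. *)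

theory Defs
  imports
    "HOL-Algebra.Algebra"
    "HOL-Algebra.Algebraic_Closure_Type"
    "HOL-Library.Poly_Mapping"
begin

section \<open>Associated primes\<close>

text \<open>\<open>R/I\<close> as an \<open>R\<close>-module: its underlying additive group is that of the factor ring, and
  \<open>R\<close> acts through the canonical homomorphism, i.e. \<open>a \<odot> (I + b) = I + a b\<close>.\<close>

definition quotient_module :: "('a, 'b) ring_scheme \<Rightarrow> 'a set \<Rightarrow> ('a, 'a set) module"
  where "quotient_module R I =
    \<lparr> carrier = carrier (R Quot I), monoid.mult = monoid.mult (R Quot I), one = one (R Quot I),
      ring.zero = ring.zero (R Quot I), ring.add = ring.add (R Quot I),
      module.smult = (\<lambda>a C. (I +>\<^bsub>R\<^esub> a) \<otimes>\<^bsub>R Quot I\<^esub> C) \<rparr>"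

definition annihilator :: "('a, 'b) ring_scheme \<Rightarrow> ('a, 'm, 'c) module_scheme \<Rightarrow> 'm \<Rightarrow> 'a set"
  where "annihilator R M m = {a \<in> carrier R. a \<odot>\<^bsub>M\<^esub> m = \<zero>\<^bsub>M\<^esub>}"

definition Ass :: "('a, 'b) ring_scheme \<Rightarrow> ('a, 'm, 'c) module_scheme \<Rightarrow> 'a set set"
  where "Ass R M = {P. primeideal P R \<and> (\<exists>m \<in> carrier M. P = annihilator R M m)}"

lemma quotient_module_simps [simp]:
  "carrier (quotient_module R I) = carrier (R Quot I)"
  "ring.add (quotient_module R I) = ring.add (R Quot I)"
  "ring.zero (quotient_module R I) = ring.zero (R Quot I)"
  "module.smult (quotient_module R I) a C = (I +>\<^bsub>R\<^esub> a) \<otimes>\<^bsub>R Quot I\<^esub> C"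
  by (simp_all add: quotient_module_def)

lemma (in cring) quotient_module_is_module:
  assumes "ideal I R"
  shows "module R (quotient_module R I)"
proof -
  interpret I: ideal I R by fact
  interpret Q: cring "R Quot I"
    using I.quotient_is_cring cring_axioms by blast
  have hom: "(\<lambda>a. I +> a) \<in> ring_hom R (R Quot I)"
    by (rule I.rcos_ring_hom)
  note h = ring_hom_closed[OF hom] ring_hom_add[OF hom] ring_hom_mult[OF hom] ring_hom_one[OF hom]
  have ag: "abelian_group (quotient_module R I)"
    by (rule abelian_groupI)
       (simp_all add: Q.a_ac)
  show ?thesis
    by (rule moduleI[OF cring_axioms ag])
       (simp_all add: h Q.l_distr Q.r_distr Q.m_assoc)
qed


section \<open>Saturation\<close>

definition ideal_quotient :: "('a, 'b) ring_scheme \<Rightarrow> 'a set \<Rightarrow> 'a set \<Rightarrow> 'a set"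
  where "ideal_quotient R I J = {f \<in> carrier R. \<forall>g \<in> J. f \<otimes>\<^bsub>R\<^esub> g \<in> I}"

text \<open>Ideal powers are powers in the multiplicative monoid of ideals; in particular
  \<open>J\<^sup>0 = R\<close>.\<close>

definition saturation :: "('a, 'b) ring_scheme \<Rightarrow> 'a set \<Rightarrow> 'a set \<Rightarrow> 'a set"
  where "saturation R I J = (\<Union>k::nat. ideal_quotient R I (J [^]\<^bsub>ideals_set R\<^esub> k))"


section \<open>Monomial ideals\<close>

text \<open>A polynomial is a finitely supported map from exponent vectors to coefficients. The index
  type \<open>'n\<close> of the variables is finite and linearly ordered; its elements, listed increasingly,
  are the indices \<open>1, \<dots>, n\<close>, where \<open>n\<close> is the cardinality of \<open>'n\<close>.\<close>

type_synonym ('n, 'k) mpoly = "('n \<Rightarrow>\<^sub>0 nat) \<Rightarrow>\<^sub>0 'k"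

abbreviation mpoly_ring :: "('n, 'k::field) mpoly ring"
  where "mpoly_ring \<equiv> ring_of_type_algebra"

definition indet :: "'n \<Rightarrow> ('n, 'k::field) mpoly"
  where "indet i = Poly_Mapping.single (Poly_Mapping.single i 1) 1"

definition monomials :: "('n, 'k::field) mpoly set"
  where "monomials = range (\<lambda>m. Poly_Mapping.single m 1)"

definition monomial_ideal :: "('n, 'k::field) mpoly set \<Rightarrow> bool"
  where "monomial_ideal I \<longleftrightarrow> (\<exists>A \<subseteq> monomials. I = Idl\<^bsub>mpoly_ring\<^esub> A)"

definition bracket_power :: "('n, 'k::field) mpoly set \<Rightarrow> nat \<Rightarrow> ('n, 'k) mpoly set"
  where "bracket_power I q = Idl\<^bsub>mpoly_ring\<^esub> {u ^ q | u. u \<in> I \<and> u \<in> monomials}"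

definition borel_type :: "('n::{finite, linorder}, 'k::field) mpoly set \<Rightarrow> bool"
  where "borel_type I \<longleftrightarrow> monomial_ideal I \<and>
    (\<forall>j. saturation mpoly_ring I (Idl\<^bsub>mpoly_ring\<^esub> {indet j}) =
         saturation mpoly_ring I (Idl\<^bsub>mpoly_ring\<^esub> (indet ` {..j})))"

end

theory Submission
  imports Defs
begin

text \<open>A monomial ideal \<open>I\<close> is the set of polynomials supported in an up-closed set \<open>U\<close> of exponent
  vectors, and \<open>I\<^sup>[\<^sup>q\<^sup>]\<close> then corresponds to \<open>{m. \<lfloor>m/q\<rfloor> \<in> U}\<close>, with \<open>\<lfloor>m/q\<rfloor>\<close> taken
  componentwise. A prime \<open>P\<close> is associated to \<open>S/I\<close> iff \<open>P\<close> is generated by a set \<open>A\<close> of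
  variables and there is \<open>m\<close> such that, for all \<open>w\<close>, \<open>m + w \<in> U\<close> iff \<open>w\<close> involves a variable of
  \<open>A\<close>. Such an \<open>m\<close> for \<open>I\<close> yields \<open>q m + (q - 1) 1\<^sub>A\<close> for \<open>I\<^sup>[\<^sup>q\<^sup>]\<close>, and such an \<open>m\<close> for
  \<open>I\<^sup>[\<^sup>q\<^sup>]\<close> yields \<open>\<lfloor>m/q\<rfloor>\<close> for \<open>I\<close>. Being of Borel type means that for \<open>i \<le> j\<close>, whenever
  \<open>m + k e\<^sub>j \<in> U\<close> for some \<open>k\<close>, also \<open>m + k e\<^sub>i \<in> U\<close> for some \<open>k\<close>; this passes to \<open>I\<^sup>[\<^sup>q\<^sup>]\<close>
  because \<open>\<lfloor>m/q\<rfloor>\<close> can be raised in coordinate \<open>i\<close> by raising \<open>m\<close> there.\<close>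

section \<open>Ideals in type-class rings, and annihilators as colon ideals\<close>

lemma ring_of_type_algebra_simps [simp]:
  fixes x y :: "'a::comm_ring_1"
  shows "carrier (ring_of_type_algebra :: 'a ring) = UNIV"
    and "x \<otimes>\<^bsub>ring_of_type_algebra\<^esub> y = x * y"
    and "x \<oplus>\<^bsub>ring_of_type_algebra\<^esub> y = x + y"
    and "\<one>\<^bsub>ring_of_type_algebra\<^esub> = (1 :: 'a)"
    and "\<zero>\<^bsub>ring_of_type_algebra\<^esub> = (0 :: 'a)"
  by (simp_all add: ring_of_type_algebra_def)

lemma ideal_ring_of_type_algebraI:
  fixes I :: "'a::comm_ring_1 set"
  assumes "0 \<in> I" "\<And>x y. x \<in> I \<Longrightarrow> y \<in> I \<Longrightarrow> x + y \<in> I" "\<And>a x. x \<in> I \<Longrightarrow> a * x \<in> I"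
  shows "ideal I ring_of_type_algebra"
proof -
  interpret cring "ring_of_type_algebra :: 'a ring" by (rule cring_from_type_algebra)
  have neg: "\<ominus>\<^bsub>ring_of_type_algebra\<^esub> x = - x" for x :: 'a
    by (rule minus_equality) simp_all
  have "- x \<in> I" if "x \<in> I" for x
    using assms(3)[OF that, of "- 1"] by simp
  moreover have "x * a \<in> I" if "x \<in> I" for a x
    using assms(3)[OF that, of a] by (simp add: mult.commute)
  ultimately show ?thesis
    using assms by (intro idealI ring_axioms add.subgroupI) (auto simp: neg simp flip: a_inv_def)
qed

lemma ideal_ring_of_type_algebraD:
  fixes I :: "'a::comm_ring_1 set"
  assumes "ideal I ring_of_type_algebra"
  shows "0 \<in> I" "x \<in> I \<Longrightarrow> y \<in> I \<Longrightarrow> x + y \<in> I" "x \<in> I \<Longrightarrow> a * x \<in> I"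
proof -
  interpret ideal I ring_of_type_algebra by fact
  show "0 \<in> I"
    using additive_subgroup.zero_closed[OF is_additive_subgroup] by simp
  show "x + y \<in> I" if "x \<in> I" "y \<in> I"
    using additive_subgroup.a_closed[OF is_additive_subgroup that] by simp
  show "a * x \<in> I" if "x \<in> I"
    using I_l_closed[OF that, of a] by simp
qed

lemma (in cring) Ass_quotient_module:
  assumes "ideal I R"
  shows "P \<in> Ass R (quotient_module R I) \<longleftrightarrow>
    primeideal P R \<and> (\<exists>f \<in> carrier R. P = {g \<in> carrier R. g \<otimes> f \<in> I})"
proof -
  interpret I: ideal I R by fact
  have carr: "carrier (quotient_module R I) = (\<lambda>f. I +> f) ` carrier R"
    by (auto simp: FactRing_simps)
  have ann: "annihilator R (quotient_module R I) (I +> f) = {g \<in> carrier R. g \<otimes> f \<in> I}"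
    if f: "f \<in> carrier R" for f
  proof -
    have "(I +> g) \<otimes>\<^bsub>R Quot I\<^esub> (I +> f) = \<zero>\<^bsub>R Quot I\<^esub> \<longleftrightarrow> g \<otimes> f \<in> I"
      if g: "g \<in> carrier R" for g
    proof -
      have "(I +> g) \<otimes>\<^bsub>R Quot I\<^esub> (I +> f) = I +> g \<otimes> f"
        by (simp add: FactRing_def I.rcoset_mult_add[OF g f])
      moreover have "\<zero>\<^bsub>R Quot I\<^esub> = I"
        by (simp add: FactRing_def)
      moreover have "I +> g \<otimes> f = I \<longleftrightarrow> g \<otimes> f \<in> I"
        using a_rcos_zero[OF assms] I.rcos_const_imp_mem[OF m_closed[OF g f]] by metis
      ultimately show ?thesis by simp
    qed
    then show ?thesis
      unfolding annihilator_def quotient_module_simps by blast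
  qed
  show ?thesis
    unfolding Ass_def carr by (auto simp: ann)
qed

section \<open>Monomials and supports\<close>

text \<open>Addition of exponents is cancellative, so \<open>m\<close> is the only exponent of
  \<open>f\<close> that contributes at \<open>m + d\<close>.\<close>

lemma lookup_times_single:
  fixes f :: "('a::cancel_comm_monoid_add) \<Rightarrow>\<^sub>0 ('b::comm_semiring_1)"
  shows "Poly_Mapping.lookup (f * Poly_Mapping.single d 1) (m + d) = Poly_Mapping.lookup f m"
proof -
  have *: "(\<Sum>q. Poly_Mapping.lookup (Poly_Mapping.single d (1::'b)) q when m + d = l + q) = (1 when l = m)" for l
  proof -
    have "(Poly_Mapping.lookup (Poly_Mapping.single d (1::'b)) q when m + d = l + q) =
          ((1 when l = m) when q = d)" for q
      by (cases "q = d"; cases "l = m") (simp_all add: lookup_single_not_eq)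
    then show ?thesis by simp
  qed
  show ?thesis unfolding lookup_mult * mult_when by simp
qed

lemma single_times_split:
  fixes m :: "'a::comm_monoid_add"
  shows "Poly_Mapping.single (d + m) c = Poly_Mapping.single d c * Poly_Mapping.single m (1::'b::comm_semiring_1)"
  by (simp add: mult_single)

lemma single_power:
  fixes m :: "'n \<Rightarrow>\<^sub>0 nat"
  shows "Poly_Mapping.single m (1::'k::comm_semiring_1) ^ q =
    Poly_Mapping.single (Poly_Mapping.map ((*) q) m) 1"
proof (induction q)
  case 0
  have "Poly_Mapping.map ((*) 0) m = 0"
    by (rule poly_mapping_eqI) (simp add: map.rep_eq)
  then show ?case by (simp only: power_0 single_one)
next
  case (Suc q)
  have "Poly_Mapping.map ((*) (Suc q)) m = m + Poly_Mapping.map ((*) q) m"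
    by (rule poly_mapping_eqI) (simp add: map.rep_eq lookup_add when_def)
  with Suc show ?case by (simp only: power_Suc mult_single mult_1)
qed

lemma sum_single_keys: "(\<Sum>m\<in>Poly_Mapping.keys f. Poly_Mapping.single m (Poly_Mapping.lookup f m)) = f"
  by (rule poly_mapping_eqI) (auto simp: lookup_sum lookup_single when_def in_keys_iff)

text \<open>Serves to split a polynomial into its part in a monomial ideal and the remaining
  part.\<close>

lemma keys_split:
  fixes f :: "'a \<Rightarrow>\<^sub>0 'b::comm_monoid_add"
  obtains g h :: "'a \<Rightarrow>\<^sub>0 'b" where "f = g + h" "Poly_Mapping.keys g = Poly_Mapping.keys f \<inter> T" "Poly_Mapping.keys h = Poly_Mapping.keys f - T"
proof
  let ?g = "Poly_Mapping.mapp (\<lambda>m c. if m \<in> T then c else 0) f"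
  let ?h = "Poly_Mapping.mapp (\<lambda>m c. if m \<in> T then 0 else c) f"
  show "f = ?g + ?h"
    by (rule poly_mapping_eqI) (auto simp: lookup_add lookup_mapp when_def in_keys_iff)
  show "Poly_Mapping.keys ?g = Poly_Mapping.keys f \<inter> T" "Poly_Mapping.keys ?h = Poly_Mapping.keys f - T"
    by (auto simp: in_keys_iff lookup_mapp when_def split: if_splits)
qed

lemma sum_in_closed:
  assumes "\<And>x. x \<in> A \<Longrightarrow> f x \<in> J" "0 \<in> J" "\<And>x y. x \<in> J \<Longrightarrow> y \<in> J \<Longrightarrow> x + y \<in> J"
  shows "sum f A \<in> J"
  using assms by (induction A rule: infinite_finite_induct) auto

definition supported_in :: "('n \<Rightarrow>\<^sub>0 nat) set \<Rightarrow> ('n, 'k::field) mpoly set"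
  where "supported_in U = {f. Poly_Mapping.keys f \<subseteq> U}"

definition up_closed :: "('n \<Rightarrow>\<^sub>0 nat) set \<Rightarrow> bool"
  where "up_closed U \<longleftrightarrow> (\<forall>m\<in>U. \<forall>m'. (\<forall>i. Poly_Mapping.lookup m i \<le> Poly_Mapping.lookup m' i) \<longrightarrow> m' \<in> U)"

lemma up_closedD: "up_closed U \<Longrightarrow> m \<in> U \<Longrightarrow> (\<And>i. Poly_Mapping.lookup m i \<le> Poly_Mapping.lookup m' i) \<Longrightarrow> m' \<in> U"
  by (auto simp: up_closed_def)

lemma up_closed_add: "up_closed U \<Longrightarrow> m \<in> U \<Longrightarrow> d + m \<in> U"
  by (erule up_closedD) (auto simp: lookup_add)

lemma pointwise_le_iff_add:
  fixes m m' :: "'n \<Rightarrow>\<^sub>0 nat"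
  shows "(\<forall>i. Poly_Mapping.lookup m i \<le> Poly_Mapping.lookup m' i) \<longleftrightarrow> (\<exists>d. m' = d + m)"
proof
  assume "\<forall>i. Poly_Mapping.lookup m i \<le> Poly_Mapping.lookup m' i"
  then have "m' = (m' - m) + m"
    by (intro poly_mapping_eqI) (simp add: lookup_add lookup_minus)
  then show "\<exists>d. m' = d + m" ..
qed (auto simp: lookup_add)

lemma single_in_supported_in [simp]:
  "Poly_Mapping.single m (1::'k::field) \<in> supported_in U \<longleftrightarrow> m \<in> U"
  by (simp add: supported_in_def)

text \<open>Multiplication by a monomial only shifts exponents, so no terms can cancel.\<close>

lemma times_single_in_supported_inD:
  "f * Poly_Mapping.single d 1 \<in> supported_in U \<Longrightarrow> m \<in> Poly_Mapping.keys f \<Longrightarrow> m + d \<in> U"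
  by (auto simp: supported_in_def in_keys_iff dest: subsetD[of _ _ "m + d"] simp: lookup_times_single)

lemma times_in_supported_inI:
  assumes "\<And>m c. m \<in> Poly_Mapping.keys f \<Longrightarrow> c \<in> Poly_Mapping.keys g \<Longrightarrow> m + c \<in> U"
  shows "f * g \<in> supported_in U"
  using assms keys_mult[of f g] by (auto simp: supported_in_def)

lemma ideal_supported_in:
  assumes "up_closed U"
  shows "ideal (supported_in U :: ('n, 'k::field) mpoly set) mpoly_ring"
proof (rule ideal_ring_of_type_algebraI)
  show "0 \<in> (supported_in U :: ('n, 'k) mpoly set)"
    by (simp add: supported_in_def)
  show "x + y \<in> supported_in U" if "x \<in> supported_in U" "y \<in> supported_in U"
    for x y :: "('n, 'k) mpoly"
    using that keys_add[of x y] by (auto simp: supported_in_def)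
  show "a * x \<in> supported_in U" if "x \<in> supported_in U" for a x :: "('n, 'k) mpoly"
    using that up_closed_add[OF assms] by (intro times_in_supported_inI) (auto simp: supported_in_def)
qed

text \<open>The right-hand side is an ideal containing the generators. Conversely, each term of a
  polynomial supported there is a multiple of a generator, and the polynomial is the sum of its
  terms.\<close>

lemma genideal_single:
  fixes M :: "('n \<Rightarrow>\<^sub>0 nat) set"
  shows "Idl\<^bsub>mpoly_ring\<^esub> ((\<lambda>m. Poly_Mapping.single m (1::'k::field)) ` M) =
    supported_in {m'. \<exists>m\<in>M. \<forall>i. Poly_Mapping.lookup m i \<le> Poly_Mapping.lookup m' i}"
    (is "?J = supported_in ?U")
proof
  interpret cring "mpoly_ring :: ('n, 'k) mpoly ring" by (rule cring_from_type_algebra)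
  have "up_closed ?U"
    by (auto simp: up_closed_def) (meson order_trans)
  then show "?J \<subseteq> supported_in ?U"
    by (intro genideal_minimal ideal_supported_in) auto
  have J: "ideal ?J mpoly_ring"
    by (rule genideal_ideal) simp
  note J = ideal_ring_of_type_algebraD[OF J]
  show "supported_in ?U \<subseteq> ?J"
  proof
    fix f :: "('n, 'k) mpoly"
    assume f: "f \<in> supported_in ?U"
    have "Poly_Mapping.single m' (Poly_Mapping.lookup f m') \<in> ?J" if "m' \<in> Poly_Mapping.keys f" for m'
    proof -
      have "m' \<in> ?U"
        using f that by (auto simp: supported_in_def)
      then obtain m d where "m \<in> M" "m' = d + m"
        unfolding pointwise_le_iff_add by blast
      moreover have "Poly_Mapping.single m 1 \<in> ?J"
        using \<open>m \<in> M\<close> by (intro genideal_self[THEN subsetD]) auto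
      ultimately show ?thesis
        by (simp only: single_times_split J(3))
    qed
    then have "(\<Sum>m\<in>Poly_Mapping.keys f. Poly_Mapping.single m (Poly_Mapping.lookup f m)) \<in> ?J"
      by (rule sum_in_closed) (use J in auto)
    then show "f \<in> ?J" by (simp add: sum_single_keys)
  qed
qed

text \<open>The exponents of the generators yield their upward closure as \<open>U\<close>;
  conversely \<open>U\<close> itself serves as the set of exponents of generators.\<close>

lemma monomial_ideal_iff:
  "monomial_ideal (I :: ('n, 'k::field) mpoly set) \<longleftrightarrow> (\<exists>U. up_closed U \<and> I = supported_in U)"
proof
  assume "monomial_ideal I"
  then obtain A where A: "A \<subseteq> monomials" "I = Idl\<^bsub>mpoly_ring\<^esub> A"
    by (auto simp: monomial_ideal_def)
  then obtain M where "A = (\<lambda>m. Poly_Mapping.single m 1) ` M"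
    unfolding monomials_def subset_image_iff by auto
  with A show "\<exists>U. up_closed U \<and> I = supported_in U"
    by (intro exI[of _ "{m'. \<exists>m\<in>M. \<forall>i. Poly_Mapping.lookup m i \<le> Poly_Mapping.lookup m' i}"])
       (auto simp: genideal_single up_closed_def; meson order_trans)
next
  assume "\<exists>U. up_closed U \<and> I = supported_in U"
  then obtain U where U: "up_closed U" "I = supported_in U" by auto
  have "{m'. \<exists>m\<in>U. \<forall>i. Poly_Mapping.lookup m i \<le> Poly_Mapping.lookup m' i} = U"
    using U(1) by (auto intro: up_closedD)
  with U(2) show "monomial_ideal I"
    unfolding monomial_ideal_def
    by (intro exI[of _ "(\<lambda>m. Poly_Mapping.single m 1) ` U"]) (auto simp: genideal_single monomials_def)
qed

section \<open>Bracket powers\<close>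

abbreviation exp_div :: "('n \<Rightarrow>\<^sub>0 nat) \<Rightarrow> nat \<Rightarrow> ('n \<Rightarrow>\<^sub>0 nat)"
  where "exp_div m q \<equiv> Poly_Mapping.map (\<lambda>k. k div q) m"

lemma lookup_exp_div [simp]: "Poly_Mapping.lookup (exp_div m q) i = Poly_Mapping.lookup m i div q"
  by (simp add: map.rep_eq when_def)

lemma lookup_map_times [simp]: "Poly_Mapping.lookup (Poly_Mapping.map ((*) q) m) i = q * (Poly_Mapping.lookup m i :: nat)"
  by (simp add: map.rep_eq when_def)

text \<open>The generators have exponents \<open>q * m\<close> with \<open>m \<in> U\<close>.
  Componentwise, \<open>q * m \<le> m'\<close> iff \<open>m \<le> exp_div m' q\<close>, and
  \<open>U\<close> is up-closed, so some generator divides \<open>m'\<close> iff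
  \<open>exp_div m' q \<in> U\<close>.\<close>

lemma bracket_power_supported_in:
  assumes "up_closed U" "q > 0"
  shows "bracket_power (supported_in U :: ('n, 'k::field) mpoly set) q =
    supported_in {m. exp_div m q \<in> U}"
proof -
  have "{u ^ q | u. u \<in> (supported_in U :: ('n, 'k) mpoly set) \<and> u \<in> monomials} =
      (\<lambda>m. Poly_Mapping.single m 1 ^ q) ` U"
    by (auto simp: monomials_def)
  then have "{u ^ q | u. u \<in> (supported_in U :: ('n, 'k) mpoly set) \<and> u \<in> monomials} =
      (\<lambda>m. Poly_Mapping.single m 1) ` Poly_Mapping.map ((*) q) ` U"
    by (simp add: image_image single_power)
  moreover have "{m'. \<exists>m\<in>Poly_Mapping.map ((*) q) ` U. \<forall>i. Poly_Mapping.lookup m i \<le> Poly_Mapping.lookup m' i} =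
      {m. exp_div m q \<in> U}"
    using assms
    by (auto simp: less_eq_div_iff_mult_less_eq mult.commute intro: up_closedD
        intro!: bexI[of _ "exp_div _ q"])
  ultimately show ?thesis by (simp only: bracket_power_def genideal_single)
qed

lemma up_closed_exp_div: "up_closed U \<Longrightarrow> up_closed {m. exp_div m q \<in> U}"
  by (auto simp: up_closed_def div_le_mono)


section \<open>Associated primes of monomial ideals\<close>

text \<open>The exponents of the monomials in the ideal generated by the variables in
  \<open>A\<close>. The complement is closed under addition, which is what makes that ideal
  prime.\<close>

definition involving :: "'n set \<Rightarrow> ('n \<Rightarrow>\<^sub>0 nat) set"
  where "involving A = {m. \<exists>i\<in>A. Poly_Mapping.lookup m i \<noteq> 0}"

lemma up_closed_involving: "up_closed (involving A)"
  unfolding up_closed_def involving_def by (auto simp: Bex_def) (metis gr0I le_zero_eq)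

lemma involving_add_iff: "m + m' \<in> involving A \<longleftrightarrow> m \<in> involving A \<or> m' \<in> involving A"
  by (auto simp: involving_def lookup_add)

text \<open>Discarding the terms in the ideal leaves \<open>f0\<close> and \<open>g0\<close>. Their
  product lies in the ideal but has no exponent in \<open>involving A\<close>, so it vanishes, and
  the ring is a domain.\<close>

lemma primeideal_supported_in_involving:
  "primeideal (supported_in (involving A) :: ('n::linorder, 'k::field) mpoly set) mpoly_ring"
proof (rule primeidealI)
  let ?P = "supported_in (involving A) :: ('n, 'k) mpoly set"
  show ideal: "ideal ?P mpoly_ring"
    by (rule ideal_supported_in[OF up_closed_involving])
  show "cring (mpoly_ring :: ('n, 'k) mpoly ring)" by (rule cring_from_type_algebra)
  have "1 \<notin> ?P"
    by (auto simp: supported_in_def involving_def)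
  then show "carrier mpoly_ring \<noteq> ?P" by auto
  fix f g :: "('n, 'k) mpoly"
  assume "f \<otimes>\<^bsub>mpoly_ring\<^esub> g \<in> ?P"
  then have fg: "f * g \<in> ?P" by simp
  note P = ideal_ring_of_type_algebraD[OF ideal]
  obtain f1 f0 where f: "f = f1 + f0" "Poly_Mapping.keys f1 = Poly_Mapping.keys f \<inter> involving A" "Poly_Mapping.keys f0 = Poly_Mapping.keys f - involving A"
    by (rule keys_split)
  obtain g1 g0 where g: "g = g1 + g0" "Poly_Mapping.keys g1 = Poly_Mapping.keys g \<inter> involving A" "Poly_Mapping.keys g0 = Poly_Mapping.keys g - involving A"
    by (rule keys_split)
  have f1g1: "f1 \<in> ?P" "g1 \<in> ?P"
    using f(2) g(2) by (auto simp: supported_in_def)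
  have "f0 * g0 = f * g + (- g) * f1 + (- f0) * g1"
    unfolding f(1) g(1) by (simp add: algebra_simps)
  also have "\<dots> \<in> ?P"
    by (intro P(2) P(3) fg f1g1)
  finally have "Poly_Mapping.keys (f0 * g0) \<subseteq> involving A"
    by (simp add: supported_in_def)
  moreover have "Poly_Mapping.keys (f0 * g0) \<subseteq> - involving A"
    using keys_mult[of f0 g0] f(3) g(3) by (auto simp: involving_add_iff)
  ultimately have "Poly_Mapping.keys (f0 * g0) = {}" by blast
  then have "f0 * g0 = 0" by simp
  then have "f0 = 0 \<or> g0 = 0" by simp
  then show "f \<in> ?P \<or> g \<in> ?P"
    using f1g1 f(1) g(1) by auto
qed


lemma genideal_indet:
  "Idl\<^bsub>mpoly_ring\<^esub> (indet ` A) = (supported_in (involving A) :: ('n, 'k::field) mpoly set)"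
proof -
  have "indet ` A = (\<lambda>m. Poly_Mapping.single m (1::'k)) ` (\<lambda>i. Poly_Mapping.single i 1) ` A"
    by (simp add: indet_def image_image)
  moreover have "{m'. \<exists>m\<in>(\<lambda>i. Poly_Mapping.single i 1) ` A. \<forall>i. Poly_Mapping.lookup m i \<le> Poly_Mapping.lookup m' i} = involving A"
    by (force simp: involving_def lookup_single when_def Suc_le_eq)
  ultimately show ?thesis by (simp only: genideal_single)
qed

lemma indet_power: "indet i ^ k = (Poly_Mapping.single (Poly_Mapping.single i k) 1 :: ('n, 'k::field) mpoly)"
  by (simp add: indet_def single_power)

text \<open>A monomial is a product of powers of variables, and a prime ideal containing a product
  contains a factor.\<close>

lemma monomial_in_primeidealD:
  fixes P :: "('n, 'k::field) mpoly set"
  assumes prime: "primeideal P mpoly_ring" and "Poly_Mapping.single w 1 \<in> P"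
  shows "w \<in> involving {i. indet i \<in> P}"
proof -
  interpret P: primeideal P mpoly_ring by fact
  have "1 \<notin> P"
    using P.one_imp_carrier P.I_notcarr by auto
  have primeD: "g \<in> P \<or> h \<in> P" if "g * h \<in> P" for g h
    using P.I_prime[of g h] that by simp
  \<comment> \<open>An infinite or empty \<open>V\<close> gives exponent \<open>0\<close>, i.e. the
    monomial \<open>1\<close>, which is not in \<open>P\<close>.\<close>
  have sumD: "\<exists>x\<in>V. Poly_Mapping.single (h x) 1 \<in> P" if "Poly_Mapping.single (sum h V) 1 \<in> P" for h and V :: "'n set"
    using that
  proof (induction V rule: infinite_finite_induct)
    case (insert x V)
    then have "Poly_Mapping.single (h x) 1 * Poly_Mapping.single (sum h V) 1 \<in> P"
      by (simp add: mult_single)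
    with insert.IH primeD show ?case by blast
  qed (use \<open>1 \<notin> P\<close> in auto)
  have powerD: "h \<in> P" if "h ^ k \<in> P" for h and k :: nat
    using that by (induction k) (use \<open>1 \<notin> P\<close> primeD in auto)
  have "Poly_Mapping.single (\<Sum>i\<in>Poly_Mapping.keys w. Poly_Mapping.single i (Poly_Mapping.lookup w i)) 1 \<in> P"
    using assms(2) by (simp only: sum_single_keys)
  then obtain i where "i \<in> Poly_Mapping.keys w" "indet i ^ Poly_Mapping.lookup w i \<in> P"
    unfolding indet_power by (blast dest: sumD)
  then show ?thesis
    using powerD by (auto simp: involving_def in_keys_iff)
qed

text \<open>Let \<open>P = (I : f)\<close> be prime, let \<open>A\<close> be the set of variables in \<open>P\<close>, and let \<open>U'\<close> be the
  support of the localisation of \<open>I\<close> at the remaining variables. Since \<open>U'\<close> is insensitive to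
  these variables, the part \<open>f\<^sub>0\<close> of \<open>f\<close> outside \<open>U'\<close> is annihilated modulo \<open>I\<close> by a
  polynomial \<open>g\<^sub>0\<close> in them only if \<open>g\<^sub>0 f\<^sub>0 = 0\<close>. So no monomial order or grading argument is
  needed to see that \<open>P\<close> is generated by \<open>A\<close>, and any exponent of \<open>f\<^sub>0\<close> is a witness.\<close>

lemma Ass_supported_in:
  fixes U :: "('n::linorder \<Rightarrow>\<^sub>0 nat) set" and P :: "('n, 'k::field) mpoly set"
  assumes U: "up_closed U"
  shows "P \<in> Ass mpoly_ring (quotient_module mpoly_ring (supported_in U)) \<longleftrightarrow>
    (\<exists>A m. P = supported_in (involving A) \<and> (\<forall>w. m + w \<in> U \<longleftrightarrow> w \<in> involving A))"
proof -
  interpret cring "mpoly_ring :: ('n, 'k) mpoly ring" by (rule cring_from_type_algebra)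
  have "\<exists>A m. P = supported_in (involving A) \<and> (\<forall>w. m + w \<in> U \<longleftrightarrow> w \<in> involving A)"
    if prime: "primeideal P mpoly_ring" and P: "P = {g. g * f \<in> supported_in U}" for f
  proof -
    interpret P: primeideal P mpoly_ring by fact
    note Pcl = ideal_ring_of_type_algebraD[OF P.is_ideal]
    define A where "A = {i. indet i \<in> P}"
    have supp_P: "supported_in (involving A) \<subseteq> P"
      unfolding genideal_indet[symmetric] by (rule genideal_minimal[OF P.is_ideal]) (auto simp: A_def)
    have not_P: "Poly_Mapping.single w 1 \<notin> P" if "w \<notin> involving A" for w
      using monomial_in_primeidealD[OF prime, of w] that unfolding A_def by blast
    define U' where "U' = {m. \<exists>w. w \<notin> involving A \<and> m + w \<in> U}"
    have "up_closed U'"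
      unfolding up_closed_def
    proof (intro ballI allI impI)
      fix m m' assume "m \<in> U'" and le: "\<forall>i. Poly_Mapping.lookup m i \<le> Poly_Mapping.lookup m' i"
      then obtain w where w: "w \<notin> involving A" "m + w \<in> U"
        by (auto simp: U'_def)
      have "m' + w \<in> U"
        by (rule up_closedD[OF U w(2)]) (simp add: lookup_add le)
      with w(1) show "m' \<in> U'" by (auto simp: U'_def)
    qed
    note I' = ideal_ring_of_type_algebraD[OF ideal_supported_in[OF this, where 'k = 'k]]
    have "U \<subseteq> U'"
      unfolding U'_def by (auto intro!: exI[of _ 0] simp: involving_def)
    \<comment> \<open>Otherwise each exponent of \<open>f\<close> is moved into \<open>U\<close> by
      some \<open>w\<close> free of \<open>A\<close>. The sum \<open>W\<close> of these finitely
      many \<open>w\<close> moves all of them, so the monomial \<open>W\<close> lies in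
      \<open>P\<close> without involving \<open>A\<close>.\<close>
    have "\<not> Poly_Mapping.keys f \<subseteq> U'"
    proof
      assume "Poly_Mapping.keys f \<subseteq> U'"
      then have "\<forall>m\<in>Poly_Mapping.keys f. \<exists>w. w \<notin> involving A \<and> m + w \<in> U"
        by (auto simp: U'_def)
      then obtain w where w: "w m \<notin> involving A" "m + w m \<in> U" if "m \<in> Poly_Mapping.keys f" for m
        by metis
      define W where "W = (\<Sum>m\<in>Poly_Mapping.keys f. w m)"
      have "W \<notin> involving A"
        using w(1) by (auto simp: W_def involving_def lookup_sum)
      moreover have "W + m \<in> U" if "m \<in> Poly_Mapping.keys f" for m
      proof -
        have "W + m = (\<Sum>m\<in>Poly_Mapping.keys f - {m}. w m) + (m + w m)"
          using that by (simp add: W_def sum.remove[of _ m] ac_simps)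
        then show ?thesis using up_closed_add[OF U w(2)[OF that]] by simp
      qed
      then have "Poly_Mapping.single W 1 * f \<in> supported_in U"
        by (intro times_in_supported_inI) auto
      then have "Poly_Mapping.single W 1 \<in> P" by (simp add: P)
      ultimately show False using not_P by blast
    qed
    then obtain m where m: "m \<in> Poly_Mapping.keys f" "m \<notin> U'" by blast
    obtain f1 f0 where f: "f = f1 + f0" "Poly_Mapping.keys f1 = Poly_Mapping.keys f \<inter> U'" "Poly_Mapping.keys f0 = Poly_Mapping.keys f - U'"
      by (rule keys_split)
    have "f0 \<noteq> 0" using m f(3) by auto
    have "P \<subseteq> supported_in (involving A)"
    proof
      fix g assume "g \<in> P"
      obtain g1 g0 where g: "g = g1 + g0" "Poly_Mapping.keys g1 = Poly_Mapping.keys g \<inter> involving A" "Poly_Mapping.keys g0 = Poly_Mapping.keys g - involving A"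
        by (rule keys_split)
      have g1: "g1 \<in> supported_in (involving A)"
        using g(2) by (auto simp: supported_in_def)
      \<comment> \<open>Only \<open>g0\<close> matters, since \<open>g1\<close> is already in
        \<open>P\<close>. Modulo the ideal of \<open>U'\<close> also \<open>f1\<close> vanishes, so
        \<open>g0 * f0\<close> is supported in \<open>U'\<close>.\<close>
      have "g0 = g + (- 1) * g1"
        by (simp add: g(1))
      also have "\<dots> \<in> P"
        using g1 supp_P by (intro Pcl \<open>g \<in> P\<close>) auto
      finally have "g0 * f \<in> supported_in U'"
        using \<open>U \<subseteq> U'\<close> by (auto simp: P supported_in_def)
      moreover have "f1 \<in> supported_in U'"
        using f(2) by (auto simp: supported_in_def)
      ultimately have "g0 * f + (- g0) * f1 \<in> supported_in U'"
        by (rule I'(2)[OF _ I'(3)])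
      then have "Poly_Mapping.keys (g0 * f0) \<subseteq> U'"
        by (simp add: f(1) algebra_simps supported_in_def)
      \<comment> \<open>Adding an exponent free of \<open>A\<close> never leads into
        \<open>U'\<close> from outside: the shift can be absorbed into \<open>w\<close>.\<close>
      moreover have "Poly_Mapping.keys (g0 * f0) \<subseteq> - U'"
      proof
        fix d assume "d \<in> Poly_Mapping.keys (g0 * f0)"
        then obtain a b where ab: "d = a + b" "a \<notin> involving A" "b \<notin> U'"
          using keys_mult[of g0 f0] g(3) f(3) by blast
        show "d \<in> - U'"
        proof
          assume "d \<in> U'"
          then obtain w where "w \<notin> involving A" "b + (a + w) \<in> U"
            by (auto simp: U'_def ab(1) ac_simps)
          moreover from this(1) ab(2) have "a + w \<notin> involving A"
            by (simp add: involving_add_iff)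
          ultimately show False using ab(3) unfolding U'_def by blast
        qed
      qed
      ultimately have "Poly_Mapping.keys (g0 * f0) = {}" by blast
      then have "g0 = 0" using \<open>f0 \<noteq> 0\<close> by simp
      with g1 show "g \<in> supported_in (involving A)" by (simp add: g(1))
    qed
    \<comment> \<open>A variable in \<open>P\<close> multiplies \<open>f\<close> into the ideal, and
      with it the single term at \<open>m\<close>.\<close>
    moreover have "m + w \<in> U \<longleftrightarrow> w \<in> involving A" for w
    proof
      show "w \<in> involving A" if "m + w \<in> U"
        using that m(2) by (auto simp: U'_def)
    next
      assume "w \<in> involving A"
      then obtain i where i: "indet i \<in> P" "Poly_Mapping.lookup w i \<noteq> 0"
        by (auto simp: involving_def A_def)
      then have "f * Poly_Mapping.single (Poly_Mapping.single i 1) 1 \<in> supported_in U"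
        by (simp add: P indet_def mult.commute)
      then have "m + Poly_Mapping.single i 1 \<in> U"
        by (rule times_single_in_supported_inD) (rule m(1))
      then show "m + w \<in> U"
        using i(2) by (elim up_closedD[OF U]) (auto simp: lookup_add lookup_single when_def)
    qed
    ultimately show ?thesis using supp_P by blast
  qed
  \<comment> \<open>Conversely, the prime is the annihilator of the class of the monomial with
    exponent \<open>m\<close>.\<close>
  moreover have "{g. g * Poly_Mapping.single m 1 \<in> supported_in U} = (supported_in (involving A) :: ('n, 'k) mpoly set)"
    if "\<forall>w. m + w \<in> U \<longleftrightarrow> w \<in> involving A" for A m
  proof (intro equalityI subsetI)
    fix g :: "('n, 'k) mpoly"
    assume "g \<in> {g. g * Poly_Mapping.single m 1 \<in> supported_in U}"
    then have "c + m \<in> U" if "c \<in> Poly_Mapping.keys g" for c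
      using times_single_in_supported_inD[OF _ that] by simp
    then show "g \<in> supported_in (involving A)"
      using that by (auto simp: supported_in_def add.commute)
  next
    fix g :: "('n, 'k) mpoly"
    assume "g \<in> supported_in (involving A)"
    then have "c + m \<in> U" if "c \<in> Poly_Mapping.keys g" for c
      using that \<open>\<forall>w. m + w \<in> U \<longleftrightarrow> w \<in> involving A\<close>
      by (auto simp: supported_in_def add.commute[of c])
    then have "g * Poly_Mapping.single m 1 \<in> supported_in U"
      by (intro times_in_supported_inI) simp
    then show "g \<in> {g. g * Poly_Mapping.single m 1 \<in> supported_in U}" by simp
  qed
  ultimately show ?thesis
    unfolding Ass_quotient_module[OF ideal_supported_in[OF U]] ring_of_type_algebra_simps
    using primeideal_supported_in_involving[where 'k = 'k] by simp blast
qed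

lemma Ass_bracket_power:
  fixes U :: "('n::{finite,linorder} \<Rightarrow>\<^sub>0 nat) set"
  assumes U: "up_closed U" and q: "q > 0"
  shows "(\<exists>m. \<forall>w. m + w \<in> U \<longleftrightarrow> w \<in> involving A) \<longleftrightarrow>
    (\<exists>m. \<forall>w. exp_div (m + w) q \<in> U \<longleftrightarrow> w \<in> involving A)"
proof
  assume "\<exists>m. \<forall>w. m + w \<in> U \<longleftrightarrow> w \<in> involving A"
  then obtain m where m: "m + w \<in> U \<longleftrightarrow> w \<in> involving A" for w by blast
  \<comment> \<open>On \<open>A\<close> the coordinates of \<open>v\<close> sit just below a
    multiple of \<open>q\<close>, so raising one by 1 already raises its quotient. Off
    \<open>A\<close> quotients may grow too, but \<open>involving A\<close> ignores them. The
    support is finite because \<open>'n\<close> is.\<close>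
  define v where "v = Abs_poly_mapping (\<lambda>i. q * Poly_Mapping.lookup m i + (if i \<in> A then q - 1 else 0))"
  have v: "Poly_Mapping.lookup v i = q * Poly_Mapping.lookup m i + (if i \<in> A then q - 1 else 0)" for i
    by (simp add: v_def)
  have "exp_div (v + w) q \<in> U \<longleftrightarrow> w \<in> involving A" for w
  proof -
    have div: "Poly_Mapping.lookup (exp_div (v + w) q) i =
        Poly_Mapping.lookup m i + ((if i \<in> A then q - 1 else 0) + Poly_Mapping.lookup w i) div q" for i
      using q by (simp add: lookup_add v add.assoc)
    then have "exp_div (v + w) q = m + (exp_div (v + w) q - m)"
      by (intro poly_mapping_eqI) (simp add: lookup_add lookup_minus)
    then have "exp_div (v + w) q \<in> U \<longleftrightarrow> exp_div (v + w) q - m \<in> involving A"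
      using m by metis
    also have "\<dots> \<longleftrightarrow> w \<in> involving A"
    proof -
      have "Poly_Mapping.lookup (exp_div (v + w) q - m) i = ((if i \<in> A then q - 1 else 0) + Poly_Mapping.lookup w i) div q" for i
        by (simp only: lookup_minus div diff_add_inverse)
      moreover have "(q - 1 + x) div q \<noteq> 0 \<longleftrightarrow> x \<noteq> 0" for x
        using q by (auto simp: div_eq_0_iff)
      ultimately show ?thesis
        unfolding involving_def mem_Collect_eq by (intro bex_cong refl) simp
    qed
    finally show ?thesis .
  qed
  then show "\<exists>m. \<forall>w. exp_div (m + w) q \<in> U \<longleftrightarrow> w \<in> involving A" by blast
next
  assume "\<exists>m. \<forall>w. exp_div (m + w) q \<in> U \<longleftrightarrow> w \<in> involving A"
  then obtain m where m: "exp_div (m + w) q \<in> U \<longleftrightarrow> w \<in> involving A" for w by blast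
  have "exp_div m q + w \<in> U \<longleftrightarrow> w \<in> involving A" for w
  proof -
    \<comment> \<open>Scaling \<open>w\<close> by \<open>q\<close> makes the division exact and, as
      \<open>q > 0\<close>, preserves which coordinates are nonzero.\<close>
    have "exp_div (m + Poly_Mapping.map ((*) q) w) q = exp_div m q + w"
      using q by (intro poly_mapping_eqI) (simp add: lookup_add)
    with m[of "Poly_Mapping.map ((*) q) w"] q show ?thesis
      by (simp add: involving_def)
  qed
  then show "\<exists>m. \<forall>w. m + w \<in> U \<longleftrightarrow> w \<in> involving A" by blast
qed

section \<open>Saturation and Borel type\<close>

text \<open>For the converse direction: a monomial of large degree in finitely many variables is
  divisible by a large power of one of them.\<close>

lemma supported_in_saturation:
  fixes U :: "('n \<Rightarrow>\<^sub>0 nat) set" and f :: "('n, 'k::field) mpoly"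
  assumes U: "up_closed U" and "finite V"
  shows "f \<in> saturation mpoly_ring (supported_in U) (Idl\<^bsub>mpoly_ring\<^esub> (indet ` V)) \<longleftrightarrow>
    (\<forall>m\<in>Poly_Mapping.keys f. \<forall>i\<in>V. \<exists>k. m + Poly_Mapping.single i k \<in> U)"
proof -
  let ?R = "mpoly_ring :: ('n, 'k) mpoly ring"
  let ?J = "Idl\<^bsub>?R\<^esub> (indet ` V)"
  interpret cring ?R by (rule cring_from_type_algebra)
  have pow_0: "?J [^]\<^bsub>ideals_set ?R\<^esub> (0::nat) = UNIV"
    by (simp add: nat_pow_def ideals_set_def)
  have pow_Suc: "?J [^]\<^bsub>ideals_set ?R\<^esub> Suc k = ideal_prod ?R (?J [^]\<^bsub>ideals_set ?R\<^esub> k) ?J" for k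
    by (simp add: nat_pow_def ideals_set_def)
  have power_mem: "Poly_Mapping.single (Poly_Mapping.single i k) 1 \<in> ?J [^]\<^bsub>ideals_set ?R\<^esub> k"
    if "i \<in> V" for i k
  proof -
    have "indet i \<in> ?J"
      using that by (intro genideal_self[THEN subsetD]) auto
    then have "indet i ^ k \<in> ?J [^]\<^bsub>ideals_set ?R\<^esub> k"
    proof (induction k)
      case 0
      show ?case unfolding pow_0 by simp
    next
      case (Suc k)
      have "indet i ^ k \<otimes>\<^bsub>?R\<^esub> indet i \<in> ideal_prod ?R (?J [^]\<^bsub>ideals_set ?R\<^esub> k) ?J"
        using Suc by (intro ideal_prod.prod)
      then show ?case
        unfolding pow_Suc by (simp add: mult.commute)
    qed
    then show ?thesis by (simp only: indet_power)
  qed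
  \<comment> \<open>For the converse it suffices to bound \<open>?J\<close> to the power
    \<open>k\<close> from above, by the polynomials whose terms all have degree at least
    \<open>k\<close> in the variables of \<open>V\<close>.\<close>
  define D :: "nat \<Rightarrow> ('n \<Rightarrow>\<^sub>0 nat) set" where "D k = {c. k \<le> (\<Sum>i\<in>V. Poly_Mapping.lookup c i)}" for k
  have D: "up_closed (D k)" for k
    unfolding up_closed_def D_def by (auto intro: order_trans sum_mono)
  have pow_D: "?J [^]\<^bsub>ideals_set ?R\<^esub> k \<subseteq> supported_in (D k)" for k
  proof (induction k)
    case 0
    then show ?case by (auto simp: supported_in_def D_def)
  next
    case (Suc k)
    have J: "?J \<subseteq> supported_in (D 1)"
      unfolding genideal_indet supported_in_def involving_def D_def
      using \<open>finite V\<close> by (fastforce simp: Suc_le_eq intro: sum_pos2)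
    show ?case
    proof
      fix h assume "h \<in> ?J [^]\<^bsub>ideals_set ?R\<^esub> Suc k"
      then have "h \<in> ideal_prod ?R (?J [^]\<^bsub>ideals_set ?R\<^esub> k) ?J"
        by (simp only: pow_Suc)
      then show "h \<in> supported_in (D (Suc k))"
      proof (induction rule: ideal_prod.induct)
        case (prod a b)
        then have "Poly_Mapping.keys a \<subseteq> D k" "Poly_Mapping.keys b \<subseteq> D 1"
          using Suc.IH J by (auto simp: supported_in_def)
        then have "a * b \<in> supported_in (D (Suc k))"
          by (intro times_in_supported_inI) (force simp: D_def lookup_add sum.distrib)
        then show ?case by simp
      next
        case (sum s t)
        then show ?case
          using ideal_ring_of_type_algebraD(2)[OF ideal_supported_in[OF D]] by simp
      qed
    qed
  qed
  show ?thesis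
  proof
    assume "f \<in> saturation ?R (supported_in U) ?J"
    then obtain k :: nat where "f \<in> ideal_quotient ?R (supported_in U) (?J [^]\<^bsub>ideals_set ?R\<^esub> k)"
      unfolding saturation_def by blast
    then have k: "f * g \<in> supported_in U" if "g \<in> ?J [^]\<^bsub>ideals_set ?R\<^esub> k" for g
      using that unfolding ideal_quotient_def by simp
    show "\<forall>m\<in>Poly_Mapping.keys f. \<forall>i\<in>V. \<exists>k. m + Poly_Mapping.single i k \<in> U"
    proof (intro ballI exI)
      fix m i assume "m \<in> Poly_Mapping.keys f" "i \<in> V"
      then show "m + Poly_Mapping.single i k \<in> U"
        using times_single_in_supported_inD[OF k[OF power_mem]] by blast
    qed
  next
    assume "\<forall>m\<in>Poly_Mapping.keys f. \<forall>i\<in>V. \<exists>k. m + Poly_Mapping.single i k \<in> U"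
    then obtain e where e: "m + Poly_Mapping.single i (e m i) \<in> U" if "m \<in> Poly_Mapping.keys f" "i \<in> V" for m i
      by metis
    \<comment> \<open>For fixed \<open>i\<close> the inner sum bounds every \<open>e m i\<close>.
      Degree at least \<open>N\<close> exceeds the total of these bounds, strictly by
      \<open>Suc\<close>, so some coordinate of \<open>c\<close> exceeds its bound. For empty
      \<open>V\<close>, \<open>D N\<close> is empty.\<close>
    define N where "N = Suc (\<Sum>i\<in>V. \<Sum>m\<in>Poly_Mapping.keys f. e m i)"
    have "f * g \<in> supported_in U" if g: "g \<in> ?J [^]\<^bsub>ideals_set ?R\<^esub> N" for g
    proof (rule times_in_supported_inI)
      fix m c assume m: "m \<in> Poly_Mapping.keys f" and "c \<in> Poly_Mapping.keys g"
      then have "c \<in> D N"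
        using pow_D[of N] g by (auto simp: supported_in_def)
      then have "(\<Sum>i\<in>V. \<Sum>m\<in>Poly_Mapping.keys f. e m i) < (\<Sum>i\<in>V. Poly_Mapping.lookup c i)"
        by (simp add: D_def N_def)
      then obtain i where i: "i \<in> V" "(\<Sum>m\<in>Poly_Mapping.keys f. e m i) < Poly_Mapping.lookup c i"
        using sum_mono[of V "Poly_Mapping.lookup c" "\<lambda>i. \<Sum>m\<in>Poly_Mapping.keys f. e m i"]
        by (meson linorder_not_le)
      moreover have "e m i \<le> (\<Sum>m\<in>Poly_Mapping.keys f. e m i)"
        using m by (intro member_le_sum) auto
      ultimately show "m + c \<in> U"
        by (intro up_closedD[OF U e[OF m i(1)]]) (auto simp: lookup_add lookup_single when_def)
    qed
    then have "f \<in> ideal_quotient ?R (supported_in U) (?J [^]\<^bsub>ideals_set ?R\<^esub> N)"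
      unfolding ideal_quotient_def by simp
    then show "f \<in> saturation ?R (supported_in U) ?J"
      unfolding saturation_def by blast
  qed
qed

text \<open>Membership in either saturation is a condition on each exponent separately, so equality
  can be tested on monomials. One inclusion is automatic, since \<open>j\<close> belongs to
  \<open>{..j}\<close>.\<close>

lemma borel_type_supported_in:
  fixes U :: "('n::{finite,linorder} \<Rightarrow>\<^sub>0 nat) set"
  assumes U: "up_closed U"
  shows "borel_type (supported_in U :: ('n, 'k::field) mpoly set) \<longleftrightarrow>
    (\<forall>j m. \<forall>i\<le>j. (\<exists>k. m + Poly_Mapping.single j k \<in> U) \<longrightarrow> (\<exists>k. m + Poly_Mapping.single i k \<in> U))"
proof -
  let ?sat = "\<lambda>V. saturation mpoly_ring (supported_in U) (Idl\<^bsub>mpoly_ring\<^esub> (indet ` V)) :: ('n, 'k) mpoly set"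
  have "?sat {j} = ?sat {..j} \<longleftrightarrow>
      (\<forall>m. \<forall>i\<le>j. (\<exists>k. m + Poly_Mapping.single j k \<in> U) \<longrightarrow> (\<exists>k. m + Poly_Mapping.single i k \<in> U))" for j
  proof
    assume eq: "?sat {j} = ?sat {..j}"
    have "Poly_Mapping.single m 1 \<in> ?sat {j} \<longleftrightarrow> Poly_Mapping.single m 1 \<in> ?sat {..j}" for m
      unfolding eq ..
    then show "\<forall>m. \<forall>i\<le>j. (\<exists>k. m + Poly_Mapping.single j k \<in> U) \<longrightarrow> (\<exists>k. m + Poly_Mapping.single i k \<in> U)"
      \<comment> \<open>Without \<open>image_insert\<close> the generating set stays an image, as
        \<open>supported_in_saturation\<close> requires.\<close>
      by (simp add: supported_in_saturation[OF U] del: image_insert)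
  next
    assume "\<forall>m. \<forall>i\<le>j. (\<exists>k. m + Poly_Mapping.single j k \<in> U) \<longrightarrow> (\<exists>k. m + Poly_Mapping.single i k \<in> U)"
    then have "f \<in> ?sat {j} \<longleftrightarrow> f \<in> ?sat {..j}" for f
      unfolding supported_in_saturation[OF U finite]
      by auto
    then show "?sat {j} = ?sat {..j}" by blast
  qed
  moreover have "monomial_ideal (supported_in U :: ('n, 'k) mpoly set)"
    using U monomial_ideal_iff by blast
  ultimately show ?thesis
    unfolding borel_type_def by simp
qed

text \<open>Raising coordinate \<open>i\<close> by \<open>k\<close> raises its quotient by at most
  \<open>k\<close>, and raising it by \<open>q * k\<close> does so by exactly \<open>k\<close>; the
  size of the raise is immaterial under the quantifier.\<close>

lemma exp_div_add_single:
  assumes U: "up_closed U" and q: "q > 0"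
  shows "(\<exists>k. exp_div (m + Poly_Mapping.single i k) q \<in> U) \<longleftrightarrow> (\<exists>k. exp_div m q + Poly_Mapping.single i k \<in> U)"
proof
  assume "\<exists>k. exp_div (m + Poly_Mapping.single i k) q \<in> U"
  then obtain k where "exp_div (m + Poly_Mapping.single i k) q \<in> U" ..
  then have "exp_div m q + Poly_Mapping.single i k \<in> U"
  proof (rule up_closedD[OF U])
    fix l
    have "(Poly_Mapping.lookup m l + k) div q \<le> (Poly_Mapping.lookup m l + q * k) div q"
      using q by (intro div_le_mono) simp
    also have "\<dots> = Poly_Mapping.lookup m l div q + k" using q by simp
    finally show "Poly_Mapping.lookup (exp_div (m + Poly_Mapping.single i k) q) l \<le> Poly_Mapping.lookup (exp_div m q + Poly_Mapping.single i k) l"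
      by (simp add: lookup_add lookup_single when_def)
  qed
  then show "\<exists>k. exp_div m q + Poly_Mapping.single i k \<in> U" ..
next
  assume "\<exists>k. exp_div m q + Poly_Mapping.single i k \<in> U"
  then obtain k where "exp_div m q + Poly_Mapping.single i k \<in> U" ..
  moreover have "exp_div (m + Poly_Mapping.single i (q * k)) q = exp_div m q + Poly_Mapping.single i k"
    using q by (intro poly_mapping_eqI) (simp add: lookup_add lookup_single when_def)
  ultimately show "\<exists>k. exp_div (m + Poly_Mapping.single i k) q \<in> U" by metis
qed

theorem lemma2p5:
  fixes I :: "('n::{finite, linorder}, 'k::field) mpoly set" and q :: nat
  assumes "infinite (UNIV :: 'k set)"
    and "card (UNIV :: 'n set) \<ge> 2"
    and "monomial_ideal I"
    and "q > 0"
  shows "Ass mpoly_ring (quotient_module mpoly_ring I) =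
         Ass mpoly_ring (quotient_module mpoly_ring (bracket_power I q))
       \<and> (borel_type I \<longrightarrow> borel_type (bracket_power I q))"
proof -
  obtain U where U: "up_closed U" and I: "I = supported_in U"
    using \<open>monomial_ideal I\<close> by (auto simp: monomial_ideal_iff)
  note U' = up_closed_exp_div[OF U, of q]
  note B = bracket_power_supported_in[OF U \<open>q > 0\<close>, where 'k = 'k]
  have "Ass mpoly_ring (quotient_module mpoly_ring I) =
      Ass mpoly_ring (quotient_module mpoly_ring (bracket_power I q))"
    using Ass_bracket_power[OF U \<open>q > 0\<close>]
    by (intro Set.set_eqI) (simp add: I B Ass_supported_in U U')
  moreover have "borel_type I \<longrightarrow> borel_type (bracket_power I q)"
    \<comment> \<open>After rewriting, the condition for the bracket power at \<open>m\<close> is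
      the condition for \<open>I\<close> at \<open>exp_div m q\<close>.\<close>
    unfolding I B borel_type_supported_in[OF U] borel_type_supported_in[OF U'] mem_Collect_eq
      exp_div_add_single[OF U \<open>q > 0\<close>]
    by blast
  ultimately show ?thesis ..
qed

end
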